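(* Let $s\geq 1$ be an integer and let $0\leq c_1<\dots<c_s\leq 1$ be real numbers. For all pairwise distinct $\lambda_1,\dots,\lambda_s\in\mathbb{C}\setminus\{1\}$, there exists a unique pair $((\theta_1,\dots,\theta_s),D)\in\mathbb{C}^s\times\mathcal{M}_s(\mathbb{C})$ such that the step defined by $(D,\theta_1,\dots,\theta_s)$ (for the nodes $c_1,\dots,c_s$) is consistent of order $s$ and the spectrum of the matrix $D$ is exactly $\{\lambda_1,\dots,\lambda_s\}$. If moreover the set $\{\lambda_1,\dots,\lambda_s\}$ is stable under complex conjugation, then $(\theta_1,\dots,\theta_s)\in\mathbb{R}^s$ and $D\in\mathcal{M}_s(\mathbb{R})$.
   Context: $\mathcal{M}_s(\mathbb{K})$ is the set of $s\times s$ matrices over $\mathbb{K}$. Given nodes $c_1,\dots,c_s$, a matrix $D$ and numbers $\theta_1,\dots,\theta_s$, the associated step is the update $(\gamma_{n+c_1},\dots,\gamma_{n+c_s})^T=D(\gamma_{n-1+c_1},\dots,\gamma_{n-1+c_s})^T+(\theta_1,\dots,\theta_s)^T N(u_n)$, where $N$ is the nonlinearity of an evolution equation and $u_n$ is the current approximation of its solution. Consistency of order $s$: for $h>0$ define the $s\times s$ matrices $V_c^h$, $V_{c-1}^h$ and $\Theta$ by $(V_c^h)_{ij}=(c_ih)^{j-1}$ and $(V_{c-1}^h)_{ij}=((c_i-1)h)^{j-1}$ for $1\leq i,j\leq s$ (with the convention $0^0=1$), and $(\Theta)_{i1}=\theta_i$, $(\Theta)_{ij}=0$ for $j\geq 2$.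 The step is said to be consistent of order $s$ (or of order $s$) if for all $h>0$, $V_c^h=D\,V_{c-1}^h+\Theta$. *)

theory Defs
  imports "Jordan_Normal_Form.Spectral_Radius"
begin

text \<open>Nodes and indices are numbered from \<open>0\<close>: \<open>c 0 < \<dots> < c (s - 1)\<close> are the nodes
  \<open>c\<^sub>1 < \<dots> < c\<^sub>s\<close>, so the exponent \<open>j - 1\<close> of column \<open>j\<close> becomes \<open>j\<close>.
  Note that \<open>0 ^ 0 = 1\<close>.\<close>

definition node_mat :: "nat \<Rightarrow> (nat \<Rightarrow> real) \<Rightarrow> real \<Rightarrow> complex mat" where
  "node_mat s c h = mat s s (\<lambda>(i, j). complex_of_real (c i * h) ^ j)"

definition theta_mat :: "nat \<Rightarrow> complex vec \<Rightarrow> complex mat" where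
  "theta_mat s \<theta> = mat s s (\<lambda>(i, j). if j = 0 then \<theta> $ i else 0)"

text \<open>Consistency of order \<open>s\<close> of the step
  \<open>(\<gamma>\<^bsub>n+c i\<^esub>)\<^sub>i = D (\<gamma>\<^bsub>n-1+c i\<^esub>)\<^sub>i + \<theta> N(u\<^sub>n)\<close>, which is given by the nodes \<open>c\<close>,
  the matrix \<open>D\<close> and the vector \<open>\<theta>\<close>.\<close>

definition consistent_step ::
    "nat \<Rightarrow> (nat \<Rightarrow> real) \<Rightarrow> complex mat \<Rightarrow> complex vec \<Rightarrow> bool" where
  "consistent_step s c D \<theta> \<longleftrightarrow>
    D \<in> carrier_mat s s \<and> \<theta> \<in> carrier_vec s \<and>
    (\<forall>h>0. node_mat s c h = D * node_mat s (\<lambda>i. c i - 1) h + theta_mat s \<theta>)"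

end

theory Submission
  imports Defs
begin

text \<open>
  Consistency of order \<open>s\<close> says that the step is exact on all polynomials \<open>p\<close> of degree
  less than \<open>s\<close>: the values \<open>p (c i)\<close> are obtained from the values \<open>p (c k - 1)\<close> through \<open>D\<close>
  and from \<open>p 0\<close> through \<open>\<theta>\<close>. Nothing in this depends on \<open>h\<close>, since scaling by \<open>h\<close> multiplies
  both sides of the equation for \<open>x ^ j\<close> by \<open>h ^ j\<close>.

  Let \<open>y\<close> be a left eigenvector of \<open>D\<close> for the eigenvalue \<open>l\<close>, and put
  \<open>r p = (\<Sum>k. y k * p (c k - 1))\<close>. Pairing the exactness equations with \<open>y\<close> gives
  \<open>r (p (x + 1)) = l * r p + (\<Sum>i. y i * \<theta> i) * p 0\<close>.
  On the binomial polynomials \<open>b j = (x gchoose j)\<close> the shift acts by Pascal's rule and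
  evaluation at \<open>0\<close> kills all but \<open>b 0\<close>, so this is a first order recursion. For \<open>l \<noteq> 1\<close> its
  solution is geometric: \<open>r (b j) = - (\<Sum>i. y i * \<theta> i) * \<mu> ^ (j + 1)\<close> with \<open>\<mu> = 1 / (l - 1)\<close>
  (lemma \<open>left_eigenvector_moments\<close>). Since \<open>s\<close> weights at distinct nodes are determined by
  their moments against \<open>b 0, \<dots>, b (s - 1)\<close>, the factor \<open>\<Sum>i. y i * \<theta> i\<close> cannot vanish; after
  scaling it to \<open>1\<close>, the vector \<open>y\<close> depends on \<open>l\<close> and the nodes only.

  For distinct \<open>l 0, \<dots>, l (s - 1)\<close> let \<open>Y\<close> be the matrix whose rows are these weight vectors.
  In the binomial basis it is a Vandermonde matrix in the distinct numbers \<open>1 / (l i - 1)\<close> with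
  rows scaled by non-zero factors, hence it is invertible (\<open>exists_geometric_moment_weights\<close>).
  If \<open>D\<close> has all \<open>l i\<close> as eigenvalues, then \<open>Y D = diag l * Y\<close> and \<open>Y \<theta> = (1, \<dots>, 1)\<close>, which
  leaves only \<open>D = Y\<^sup>-\<^sup>1 diag l * Y\<close> and \<open>\<theta> = Y\<^sup>-\<^sup>1 (1, \<dots>, 1)\<close>; running the recursion backwards,
  this pair is a solution (\<open>step_with_spectrum_characterization\<close>). As the nodes are real, the
  entrywise conjugate of a solution solves the problem for the conjugate eigenvalues. If these
  are the same numbers, uniqueness makes the solution real.
\<close>

section \<open>Linear algebra with families of numbers\<close>

lemma sum_mult_sum_swap:
  fixes a c :: "nat \<Rightarrow> 'a :: comm_semiring_0"
  shows "(\<Sum>k<s. (\<Sum>l<s. a l * b l k) * c k) = (\<Sum>l<s. a l * (\<Sum>k<s. b l k * c k))"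
  unfolding sum_distrib_left sum_distrib_right
  by (subst sum.swap) (simp add: mult.assoc)

lemma sum_delta_lessThan:
  fixes f :: "nat \<Rightarrow> 'a :: semiring_1"
  assumes "i < s"
  shows "(\<Sum>k<s. (if i = k then 1 else 0) * f k) = f i"
proof -
  have "(\<Sum>k<s. (if i = k then 1 else 0) * f k) = (\<Sum>k<s. if i = k then f k else 0)"
    by (rule sum.cong) auto
  then show ?thesis using assms by simp
qed

text \<open>
  Families indexed by \<open>{..<s}\<close> stand for square matrices here, so that polynomial identities
  at the nodes can be combined by rearranging sums.
\<close>

lemma family_inverse_exists:
  fixes A :: "nat \<Rightarrow> nat \<Rightarrow> 'a :: field"
  assumes ker: "\<And>a. (\<And>j. j < s \<Longrightarrow> (\<Sum>i<s. a i * A i j) = 0) \<Longrightarrow> (\<And>i. i < s \<Longrightarrow> a i = 0)"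
  obtains B where
    "\<And>i j. i < s \<Longrightarrow> j < s \<Longrightarrow> (\<Sum>k<s. A i k * B k j) = (if i = j then 1 else 0)"
    "\<And>i j. i < s \<Longrightarrow> j < s \<Longrightarrow> (\<Sum>k<s. B i k * A k j) = (if i = j then 1 else 0)"
proof -
  define M where "M = mat s s (\<lambda>(i, j). A j i)"
  have M: "M \<in> carrier_mat s s" by (simp add: M_def)
  have "det M \<noteq> 0"
  proof
    assume "det M = 0"
    then obtain v where v: "v \<in> carrier_vec s" "v \<noteq> 0\<^sub>v s" "M *\<^sub>v v = 0\<^sub>v s"
      using det_0_iff_vec_prod_zero_field[OF M] by blast
    have "(\<Sum>i<s. v $ i * A i j) = 0" if "j < s" for j
    proof -
      have "(M *\<^sub>v v) $ j = (\<Sum>i<s. v $ i * A i j)"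
        using that v(1) by (auto simp: M_def scalar_prod_def atLeast0LessThan mult.commute
            intro!: sum.cong)
      then show ?thesis using v(3) that by simp
    qed
    then have "v $ i = 0" if "i < s" for i using ker[of "\<lambda>i. v $ i"] that by blast
    then have "v = 0\<^sub>v s" using v(1) by (intro eq_vecI) auto
    with v(2) show False by simp
  qed
  then obtain N where N: "N \<in> carrier_mat s s" "N * M = 1\<^sub>m s" "M * N = 1\<^sub>m s"
    using det_non_zero_imp_unit[OF M, of "()"] unfolding Units_def ring_mat_def by auto
  show ?thesis
  proof (rule that[of "\<lambda>i j. N $$ (j, i)"])
    fix i j assume ij: "i < s" "j < s"
    have "(N * M) $$ (j, i) = (\<Sum>k<s. A i k * N $$ (j, k))"
      using N(1) ij by (auto simp: M_def scalar_prod_def atLeast0LessThan mult.commute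
            intro!: sum.cong)
    then show "(\<Sum>k<s. A i k * N $$ (j, k)) = (if i = j then 1 else 0)"
      using N(2) ij by auto
    have "(M * N) $$ (j, i) = (\<Sum>k<s. N $$ (k, i) * A k j)"
      using N(1) ij by (auto simp: M_def scalar_prod_def atLeast0LessThan mult.commute
            intro!: sum.cong)
    then show "(\<Sum>k<s. N $$ (k, i) * A k j) = (if i = j then 1 else 0)"
      using N(3) ij by auto
  qed
qed

text \<open>
  A matrix and its transpose have the same characteristic polynomial.
\<close>

lemma mem_spectrum_iff_left_eigenvector:
  fixes D :: "'a :: field mat"
  assumes D: "D \<in> carrier_mat s s"
  shows "k \<in> spectrum D \<longleftrightarrow>
    (\<exists>y. (\<exists>i<s. y i \<noteq> 0) \<and> (\<forall>j<s. (\<Sum>i<s. y i * D $$ (i, j)) = k * y j))"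
proof -
  have DT: "transpose_mat D \<in> carrier_mat s s" using D by simp
  have entry: "(transpose_mat D *\<^sub>v v) $ j = (\<Sum>i<s. v $ i * D $$ (i, j))"
    if "v \<in> carrier_vec s" "j < s" for v j
    using that D by (auto simp: scalar_prod_def atLeast0LessThan mult.commute intro!: sum.cong)
  have "k \<in> spectrum D \<longleftrightarrow> eigenvalue (transpose_mat D) k"
    using eigenvalue_root_char_poly[OF D] eigenvalue_root_char_poly[OF DT] D
    by (simp add: spectrum_def)
  also have "\<dots> \<longleftrightarrow> (\<exists>y. (\<exists>i<s. y i \<noteq> 0) \<and> (\<forall>j<s. (\<Sum>i<s. y i * D $$ (i, j)) = k * y j))"
    (is "_ \<longleftrightarrow> ?R")
  proof
    assume "eigenvalue (transpose_mat D) k"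
    then obtain v where v: "v \<in> carrier_vec s" "v \<noteq> 0\<^sub>v s"
        "transpose_mat D *\<^sub>v v = k \<cdot>\<^sub>v v"
      using D by (auto simp: eigenvalue_def eigenvector_def)
    have "\<exists>i<s. v $ i \<noteq> 0"
    proof (rule ccontr)
      assume "\<not> ?thesis"
      then have "v = 0\<^sub>v s" using v(1) by (intro eq_vecI) auto
      with v(2) show False by simp
    qed
    moreover have "(\<Sum>i<s. v $ i * D $$ (i, j)) = k * v $ j" if "j < s" for j
      using entry[OF v(1) that] v(1,3) that by simp
    ultimately show ?R by (intro exI[of _ "\<lambda>i. v $ i"]) blast
  next
    assume ?R
    then obtain y where y: "\<exists>i<s. y i \<noteq> 0"
      "\<forall>j<s. (\<Sum>i<s. y i * D $$ (i, j)) = k * y j" by blast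
    have "transpose_mat D *\<^sub>v vec s y = k \<cdot>\<^sub>v vec s y"
      using y(2) entry[of "vec s y"] D by (intro eq_vecI) auto
    moreover have "vec s y \<noteq> 0\<^sub>v s" using y(1) by (metis index_vec index_zero_vec(1))
    ultimately show "eigenvalue (transpose_mat D) k"
      using D by (auto simp: eigenvalue_def eigenvector_def intro!: exI[of _ "vec s y"])
  qed
  finally show ?thesis .
qed

section \<open>Moments against a graded basis of polynomials\<close>

text \<open>
  A sequence with one polynomial of each degree spans: subtracting the right multiple of
  \<open>B n\<close> from a polynomial of degree \<open>n\<close> lowers the degree. The induction form lets a property
  that is closed under linear combinations pass from a basis to all polynomials; it is used
  with monomials and with binomial polynomials.
\<close>

lemma poly_induct_graded_basis:
  fixes P :: "'a :: field poly \<Rightarrow> bool"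
  assumes deg: "\<And>j. degree (B j) = j" and nz: "B 0 \<noteq> 0"
    and zero: "P 0"
    and step: "\<And>p a j. j < s \<Longrightarrow> P p \<Longrightarrow> P (p + Polynomial.smult a (B j))"
    and p: "degree p < s"
  shows "P p"
  using p
proof (induction "degree p" arbitrary: p rule: less_induct)
  case less
  define n where "n = degree p"
  have "B n \<noteq> 0" using nz deg[of n] by (cases n) auto
  then have Bn: "coeff (B n) n \<noteq> 0" using leading_coeff_0_iff[of "B n"] by (simp only: deg not_False_eq_True)
  define a where "a = coeff p n / coeff (B n) n"
  define q where "q = p - Polynomial.smult a (B n)"
  have pq: "p = q + Polynomial.smult a (B n)" by (simp add: q_def)
  have cq: "coeff q n = 0" using Bn by (simp add: q_def a_def)
  have dq: "degree q \<le> n" unfolding q_def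
    by (rule degree_diff_le) (use degree_smult_le[of a "B n"] deg[of n] in \<open>simp_all add: n_def\<close>)
  have "P q"
  proof (cases "q = 0")
    case False
    then have "degree q < n" using cq dq leading_coeff_0_iff[of q] by (cases "degree q = n") auto
    then show ?thesis using less by (simp add: n_def)
  qed (simp add: zero)
  then have "P (q + Polynomial.smult a (B n))" using step less.prems by (simp add: n_def)
  then show ?case by (simp only: pq[symmetric])
qed

text \<open>
  Vanishing moments against a basis are vanishing moments against every polynomial of degree
  less than \<open>s\<close>, in particular against the Lagrange polynomial that is zero at all nodes
  except \<open>x i\<close>.
\<close>

lemma weights_zero_if_moments_zero:
  fixes x :: "nat \<Rightarrow> 'a :: field"
  assumes inj: "inj_on x {..<s}"
    and deg: "\<And>j. degree (B j) = j" and nz: "B 0 \<noteq> 0"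
    and mom: "\<And>j. j < s \<Longrightarrow> (\<Sum>k<s. a k * poly (B j) (x k)) = 0"
    and i: "i < s"
  shows "a i = 0"
proof -
  have all: "(\<Sum>k<s. a k * poly p (x k)) = 0" if "degree p < s" for p
  proof (rule poly_induct_graded_basis[where P = "\<lambda>p. (\<Sum>k<s. a k * poly p (x k)) = 0"
        and B = B, OF deg nz _ _ that])
    fix p b j
    assume j: "j < s" and p: "(\<Sum>k<s. a k * poly p (x k)) = 0"
    have "(\<Sum>k<s. a k * poly (p + Polynomial.smult b (B j)) (x k))
        = (\<Sum>k<s. a k * poly p (x k)) + b * (\<Sum>k<s. a k * poly (B j) (x k))"
      by (simp add: sum.distrib sum_distrib_left algebra_simps)
    then show "(\<Sum>k<s. a k * poly (p + Polynomial.smult b (B j)) (x k)) = 0" using p mom[OF j] by simp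
  qed simp
  define L where "L = (\<Prod>k\<in>{..<s} - {i}. [:- x k, 1:])"
  have "degree L \<le> (\<Sum>k\<in>{..<s} - {i}. degree [:- x k, 1:])"
    using degree_prod_sum_le[of "{..<s} - {i}" "\<lambda>k. [:- x k, 1:]"] by (simp add: L_def o_def)
  also have "\<dots> < s" using i by simp
  finally have "degree L < s" .
  from all[OF this] have "(\<Sum>k<s. a k * poly L (x k)) = 0" .
  moreover have "(\<Sum>k<s. a k * poly L (x k)) = a i * poly L (x i)"
  proof -
    have "(\<Sum>k<s. a k * poly L (x k)) = (\<Sum>k\<in>{i}. a k * poly L (x k))"
    proof (rule sum.mono_neutral_right)
      show "\<forall>k\<in>{..<s} - {i}. a k * poly L (x k) = 0"
        by (auto simp: L_def poly_prod prod_zero_iff)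
    qed (use i in auto)
    then show ?thesis by simp
  qed
  moreover have "poly L (x i) \<noteq> 0"
    using inj i by (auto simp: L_def poly_prod prod_zero_iff inj_on_def)
  ultimately show ?thesis by simp
qed

definition binomial_poly :: "nat \<Rightarrow> 'a :: field_char_0 poly" where
  "binomial_poly j = Polynomial.smult (1 / fact j) (\<Prod>i<j. [:- of_nat i, 1:])"

lemma poly_binomial_poly: "poly (binomial_poly j) x = x gchoose j"
  by (simp add: binomial_poly_def poly_prod gbinomial_prod_rev atLeast0LessThan)

lemma degree_binomial_poly: "degree (binomial_poly j :: 'a :: field_char_0 poly) = j"
  by (simp add: binomial_poly_def degree_prod_eq_sum_degree)

lemma binomial_poly_0: "binomial_poly 0 = 1"
  by (simp add: binomial_poly_def)

lemma weights_zero_if_binomial_moments_zero: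
  fixes x :: "nat \<Rightarrow> 'a :: field_char_0"
  assumes inj: "inj_on x {..<s}"
    and mom: "\<And>j. j < s \<Longrightarrow> (\<Sum>k<s. a k * poly (binomial_poly j) (x k - 1)) = 0"
    and i: "i < s"
  shows "a i = 0"
proof (rule weights_zero_if_moments_zero[where a = a and B = binomial_poly])
  show "inj_on (\<lambda>k. x k - 1) {..<s}" using inj by (simp add: inj_on_def)
qed (use mom i in \<open>simp_all add: degree_binomial_poly binomial_poly_0\<close>)

section \<open>Steps that are exact on polynomials\<close>

text \<open>
  For monomials this is the equation for one column of \<open>V\<^sub>c = D * V\<^bsub>c-1\<^esub> + \<Theta>\<close> at \<open>h = 1\<close>. The factor
  \<open>poly p 0\<close> makes \<open>t\<close> enter for the constant monomial only.
\<close>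

definition exact_step ::
    "nat \<Rightarrow> (nat \<Rightarrow> 'a) \<Rightarrow> (nat \<Rightarrow> nat \<Rightarrow> 'a) \<Rightarrow> (nat \<Rightarrow> 'a) \<Rightarrow> 'a :: field poly \<Rightarrow> bool" where
  "exact_step s x d t p \<longleftrightarrow>
    (\<forall>i<s. poly p (x i) = (\<Sum>k<s. d i k * poly p (x k - 1)) + t i * poly p 0)"

lemma exact_step_0: "exact_step s x d t 0"
  by (simp add: exact_step_def)

lemma exact_step_add_smult:
  assumes "exact_step s x d t p" "exact_step s x d t q"
  shows "exact_step s x d t (p + Polynomial.smult b q)"
  using assms unfolding exact_step_def
  by (simp add: sum.distrib sum_distrib_left algebra_simps)

lemma exact_step_from_basis:
  assumes "\<And>j. degree (B j) = j" "B 0 \<noteq> 0"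
    and "\<And>j. j < s \<Longrightarrow> exact_step s x d t (B j)" "degree p < s"
  shows "exact_step s x d t p"
proof (rule poly_induct_graded_basis[where P = "exact_step s x d t" and B = B])
  show "exact_step s x d t (q + Polynomial.smult a (B j))"
    if "j < s" "exact_step s x d t q" for q a j
    using exact_step_add_smult that assms(3) by blast
qed (use assms exact_step_0 in auto)

lemma consistent_step_iff_exact:
  assumes D: "D \<in> carrier_mat s s" and t: "\<theta> \<in> carrier_vec s"
  shows "consistent_step s c D \<theta> \<longleftrightarrow>
    (\<forall>p. degree p < s \<longrightarrow>
      exact_step s (\<lambda>i. complex_of_real (c i)) (\<lambda>i k. D $$ (i, k)) (\<lambda>i. \<theta> $ i) p)"
    (is "_ \<longleftrightarrow> (\<forall>p. _ \<longrightarrow> ?E p)")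
proof -
  define eqn where "eqn h i j \<longleftrightarrow> complex_of_real (c i * h) ^ j =
      (\<Sum>k<s. D $$ (i, k) * complex_of_real ((c k - 1) * h) ^ j) + (if j = 0 then \<theta> $ i else 0)"
    for h :: real and i j :: nat
  have mat_eq: "node_mat s c h = D * node_mat s (\<lambda>i. c i - 1) h + theta_mat s \<theta> \<longleftrightarrow>
      (\<forall>i<s. \<forall>j<s. eqn h i j)" for h
    using D t by (auto simp: mat_eq_iff node_mat_def theta_mat_def eqn_def scalar_prod_def
        atLeast0LessThan)
  have scale: "eqn h i j \<longleftrightarrow> eqn 1 i j" if "h > 0" for h i j
  proof (cases "j = 0")
    case False
    have "(\<Sum>k<s. D $$ (i, k) * complex_of_real ((c k - 1) * h) ^ j) =
        complex_of_real h ^ j * (\<Sum>k<s. D $$ (i, k) * complex_of_real (c k - 1) ^ j)"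
      by (simp add: sum_distrib_left power_mult_distrib mult_ac)
    then show ?thesis using that False
      by (simp add: eqn_def power_mult_distrib mult.commute)
  qed (simp add: eqn_def)
  have monom: "?E (Polynomial.monom 1 j) \<longleftrightarrow> (\<forall>i<s. eqn 1 i j)" for j
    by (simp add: exact_step_def eqn_def poly_monom power_0_left)
  have "consistent_step s c D \<theta> \<longleftrightarrow> (\<forall>h>0. \<forall>i<s. \<forall>j<s. eqn h i j)"
    using D t by (simp add: consistent_step_def mat_eq)
  also have "\<dots> \<longleftrightarrow> (\<forall>i<s. \<forall>j<s. eqn 1 i j)"
  proof
    assume "\<forall>h>0. \<forall>i<s. \<forall>j<s. eqn h i j"
    then show "\<forall>i<s. \<forall>j<s. eqn 1 i j" by simp
  qed (use scale in blast)
  also have "\<dots> \<longleftrightarrow> (\<forall>j<s. ?E (Polynomial.monom 1 j))"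
    unfolding monom by blast
  also have "\<dots> \<longleftrightarrow> (\<forall>p. degree p < s \<longrightarrow> ?E p)"
  proof
    assume "\<forall>j<s. ?E (Polynomial.monom 1 j)"
    then have "?E p" if "degree p < s" for p
      using that exact_step_from_basis[where B = "Polynomial.monom 1" and s = s and p = p]
      by (simp add: degree_monom_eq)
    then show "\<forall>p. degree p < s \<longrightarrow> ?E p" by blast
  qed (simp add: degree_monom_eq)
  finally show ?thesis .
qed

section \<open>Left eigenvectors of an exact step\<close>

lemma exact_step_pair_left:
  assumes E: "exact_step s x d t p"
    and y: "\<And>k. k < s \<Longrightarrow> (\<Sum>i<s. y i * d i k) = l * y k"
  shows "(\<Sum>i<s. y i * poly p (x i)) =
    l * (\<Sum>k<s. y k * poly p (x k - 1)) + (\<Sum>i<s. y i * t i) * poly p 0"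
proof -
  have "(\<Sum>i<s. y i * poly p (x i)) =
      (\<Sum>i<s. y i * (\<Sum>k<s. d i k * poly p (x k - 1))) + (\<Sum>i<s. y i * t i) * poly p 0"
    using E by (simp add: exact_step_def sum.distrib sum_distrib_left sum_distrib_right algebra_simps)
  also have "(\<Sum>i<s. y i * (\<Sum>k<s. d i k * poly p (x k - 1))) =
      (\<Sum>k<s. (\<Sum>i<s. y i * d i k) * poly p (x k - 1))"
    by (rule sum_mult_sum_swap[symmetric])
  also have "\<dots> = l * (\<Sum>k<s. y k * poly p (x k - 1))"
    using y by (simp add: sum_distrib_left mult.assoc)
  finally show ?thesis .
qed

text \<open>
  Pascal's rule: the shift by \<open>1\<close> maps \<open>x gchoose Suc j\<close> to
  \<open>(x gchoose j) + (x gchoose Suc j)\<close>.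
\<close>

lemma sum_binomial_shift:
  fixes x :: "nat \<Rightarrow> 'a :: field_char_0"
  shows "(\<Sum>i<s. y i * poly (binomial_poly (Suc j)) (x i)) =
    (\<Sum>i<s. y i * poly (binomial_poly j) (x i - 1)) +
    (\<Sum>i<s. y i * poly (binomial_poly (Suc j)) (x i - 1))"
proof -
  have "x i gchoose Suc j = (x i - 1 gchoose j) + (x i - 1 gchoose Suc j)" for i
    using gbinomial_Suc_Suc[of "x i - 1" j] by simp
  then show ?thesis by (simp add: poly_binomial_poly sum.distrib algebra_simps)
qed

text \<open>
  With \<open>b = (\<Sum>i<s. y i * t i)\<close>, the moments \<open>m j\<close> satisfy \<open>m 0 = l * m 0 + b\<close> and
  \<open>m j + m (Suc j) = l * m (Suc j)\<close>, so each one arises from the one before by the factor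
  \<open>1 / (l - 1)\<close>. Both \<open>b = 0\<close> and \<open>b = 1\<close> matter below: the first leads to \<open>y = 0\<close>, the second
  is the normalization.
\<close>

lemma left_eigenvector_moments:
  fixes x :: "nat \<Rightarrow> 'a :: field_char_0"
  assumes E: "\<And>p. degree p < s \<Longrightarrow> exact_step s x d t p"
    and y: "\<And>k. k < s \<Longrightarrow> (\<Sum>i<s. y i * d i k) = l * y k"
    and l: "l \<noteq> 1" and j: "j < s"
  shows "(\<Sum>k<s. y k * poly (binomial_poly j) (x k - 1)) =
    - (\<Sum>i<s. y i * t i) * (1 / (l - 1)) ^ Suc j"
  using j
proof (induction j)
  case 0
  have "(\<Sum>k<s. y k) = l * (\<Sum>k<s. y k) + (\<Sum>i<s. y i * t i)"
    using exact_step_pair_left[OF E[of 1] y] 0 by simp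
  then show ?case using l by (simp add: binomial_poly_0 field_simps)
next
  case (Suc j)
  define m where "m j = (\<Sum>k<s. y k * poly (binomial_poly j) (x k - 1))" for j
  have "m j + m (Suc j) = l * m (Suc j)"
    using exact_step_pair_left[OF E[of "binomial_poly (Suc j)"] y] Suc.prems
    by (simp add: degree_binomial_poly sum_binomial_shift[where x = x] m_def poly_binomial_poly[of _ 0])
  then have "m (Suc j) = m j * (1 / (l - 1))" using l by (simp add: field_simps)
  then show ?case using Suc by (simp add: m_def)
qed

section \<open>The spectrum determines the step\<close>

text \<open>
  The rows of \<open>Y\<close> are the only candidates for normalized left eigenvectors. They exist because
  the binomial polynomials at distinct nodes form an invertible matrix \<open>W\<close>. A linear relation
  between them is, on the side of the moments, a vanishing combination of the geometric
  sequences with ratios \<open>1 / (l i - 1)\<close>. Those moments are moments against monomials at the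
  distinct nodes \<open>1 / (l i - 1)\<close>, so the relation is trivial.
\<close>

lemma exists_geometric_moment_weights:
  fixes x l :: "nat \<Rightarrow> 'a :: field_char_0"
  assumes inj: "inj_on x {..<s}" and injl: "inj_on l {..<s}" and l1: "\<And>i. i < s \<Longrightarrow> l i \<noteq> 1"
  obtains Y Z where
    "\<And>i j. i < s \<Longrightarrow> j < s \<Longrightarrow> (\<Sum>k<s. Y i k * poly (binomial_poly j) (x k - 1)) =
        - ((1 / (l i - 1)) ^ Suc j)"
    "\<And>i j. i < s \<Longrightarrow> j < s \<Longrightarrow> (\<Sum>k<s. Y i k * Z k j) = (if i = j then 1 else 0)"
    "\<And>i j. i < s \<Longrightarrow> j < s \<Longrightarrow> (\<Sum>k<s. Z i k * Y k j) = (if i = j then 1 else 0)"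
proof -
  define W where "W k j = poly (binomial_poly j) (x k - 1)" for k j
  define \<mu> where "\<mu> i = 1 / (l i - 1)" for i
  have inj\<mu>: "inj_on \<mu> {..<s}" using injl l1 by (auto simp: inj_on_def \<mu>_def)
  obtain V where V: "\<And>i j. i < s \<Longrightarrow> j < s \<Longrightarrow>
      (\<Sum>k<s. V i k * W k j) = (if i = j then 1 else 0)"
  proof (rule family_inverse_exists[of s W])
    fix a :: "nat \<Rightarrow> 'a" and i
    assume "\<And>j. j < s \<Longrightarrow> (\<Sum>i<s. a i * W i j) = 0" "i < s"
    then show "a i = 0" unfolding W_def
      using weights_zero_if_binomial_moments_zero[of x s a i, OF inj] by blast
  qed blast
  define Y where "Y i k = (\<Sum>m<s. - (\<mu> i ^ Suc m) * V m k)" for i k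
  have mom: "(\<Sum>k<s. Y i k * W k j) = - (\<mu> i ^ Suc j)" if "j < s" for i j
  proof -
    have "(\<Sum>k<s. Y i k * W k j) = (\<Sum>m<s. - (\<mu> i ^ Suc m) * (\<Sum>k<s. V m k * W k j))"
      unfolding Y_def by (rule sum_mult_sum_swap)
    also have "\<dots> = (\<Sum>m<s. (if j = m then 1 else 0) * - (\<mu> i ^ Suc m))"
      using that V by (intro sum.cong) auto
    also have "\<dots> = - (\<mu> i ^ Suc j)" using that by (rule sum_delta_lessThan)
    finally show ?thesis .
  qed
  obtain Z where Z:
    "\<And>i j. i < s \<Longrightarrow> j < s \<Longrightarrow> (\<Sum>k<s. Y i k * Z k j) = (if i = j then 1 else 0)"
    "\<And>i j. i < s \<Longrightarrow> j < s \<Longrightarrow> (\<Sum>k<s. Z i k * Y k j) = (if i = j then 1 else 0)"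
  proof (rule family_inverse_exists[of s Y])
    fix a :: "nat \<Rightarrow> 'a" and i
    assume a: "\<And>k. k < s \<Longrightarrow> (\<Sum>i<s. a i * Y i k) = 0" and i: "i < s"
    have "(\<Sum>i<s. (a i * \<mu> i) * poly (Polynomial.monom 1 j) (\<mu> i)) = 0" if "j < s" for j
    proof -
      have "(\<Sum>i<s. (a i * \<mu> i) * poly (Polynomial.monom 1 j) (\<mu> i)) =
          - (\<Sum>i<s. a i * (\<Sum>k<s. Y i k * W k j))"
        using that by (simp add: mom poly_monom sum_negf mult.assoc)
      also have "\<dots> = - (\<Sum>k<s. (\<Sum>i<s. a i * Y i k) * W k j)"
        by (simp only: sum_mult_sum_swap)
      finally show ?thesis using a by simp
    qed
    then have "a i * \<mu> i = 0"
      using weights_zero_if_moments_zero[OF inj\<mu>, of "Polynomial.monom 1" "\<lambda>i. a i * \<mu> i" i] i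
      by (simp add: degree_monom_eq)
    then show "a i = 0" using l1[OF i] by (simp add: \<mu>_def)
  qed blast
  show ?thesis using that[of Y Z] mom Z by (simp add: W_def \<mu>_def)
qed

text \<open>
  If a left eigenvector were orthogonal to \<open>t\<close>, all its moments would vanish, and so would
  the eigenvector itself.
\<close>

lemma normalized_left_eigenvector:
  fixes x :: "nat \<Rightarrow> 'a :: field_char_0"
  assumes inj: "inj_on x {..<s}"
    and D: "D \<in> carrier_mat s s"
    and E: "\<And>p. degree p < s \<Longrightarrow> exact_step s x (\<lambda>i k. D $$ (i, k)) t p"
    and l: "l \<in> spectrum D" "l \<noteq> 1"
  obtains y where "\<And>k. k < s \<Longrightarrow> (\<Sum>i<s. y i * D $$ (i, k)) = l * y k"
    "(\<Sum>i<s. y i * t i) = 1"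
proof -
  obtain z where nz: "\<exists>i<s. z i \<noteq> 0"
    and z: "\<And>k. k < s \<Longrightarrow> (\<Sum>i<s. z i * D $$ (i, k)) = l * z k"
    using l(1) mem_spectrum_iff_left_eigenvector[OF D] by blast
  define b where "b = (\<Sum>i<s. z i * t i)"
  have "b \<noteq> 0"
  proof
    assume "b = 0"
    then have "(\<Sum>k<s. z k * poly (binomial_poly j) (x k - 1)) = 0" if "j < s" for j
      using left_eigenvector_moments[OF E z l(2) that] by (simp add: b_def)
    then have "z i = 0" if "i < s" for i
      using weights_zero_if_binomial_moments_zero[of x s z i, OF inj] that by blast
    with nz show False by blast
  qed
  show ?thesis
  proof (rule that[of "\<lambda>i. z i / b"])
    show "(\<Sum>i<s. z i / b * D $$ (i, k)) = l * (z k / b)" if "k < s" for k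
      using z[OF that] by (simp add: sum_divide_distrib[symmetric])
    show "(\<Sum>i<s. z i / b * t i) = 1"
      using \<open>b \<noteq> 0\<close> by (simp add: sum_divide_distrib[symmetric] b_def)
  qed
qed

text \<open>
  Existence and uniqueness in one equivalence. The solution is \<open>d = Z * diag l * Y\<close> and
  \<open>t = Z * (1, \<dots>, 1)\<close>, where \<open>Z\<close> is the inverse of the matrix \<open>Y\<close> of geometric moment weights.
\<close>

lemma step_with_spectrum_characterization:
  fixes x l :: "nat \<Rightarrow> 'a :: field_char_0"
  assumes inj: "inj_on x {..<s}" and injl: "inj_on l {..<s}" and l1: "\<And>i. i < s \<Longrightarrow> l i \<noteq> 1"
  obtains d t where
    "\<And>D \<theta>. D \<in> carrier_mat s s \<Longrightarrow> \<theta> \<in> carrier_vec s \<Longrightarrow>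
      (\<forall>p. degree p < s \<longrightarrow> exact_step s x (\<lambda>i k. D $$ (i, k)) (\<lambda>i. \<theta> $ i) p) \<and>
        l ` {..<s} \<subseteq> spectrum D \<longleftrightarrow>
      D = mat s s (\<lambda>(i, k). d i k) \<and> \<theta> = vec s t"
proof -
  obtain Y Z where mom: "\<And>i j. i < s \<Longrightarrow> j < s \<Longrightarrow>
        (\<Sum>k<s. Y i k * poly (binomial_poly j) (x k - 1)) = - ((1 / (l i - 1)) ^ Suc j)"
    and YZ: "\<And>i j. i < s \<Longrightarrow> j < s \<Longrightarrow> (\<Sum>k<s. Y i k * Z k j) = (if i = j then 1 else 0)"
    and ZY: "\<And>i j. i < s \<Longrightarrow> j < s \<Longrightarrow> (\<Sum>k<s. Z i k * Y k j) = (if i = j then 1 else 0)"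
    using exists_geometric_moment_weights[OF inj injl l1] by blast
  have Z_Y: "(\<Sum>m<s. Z i m * (\<Sum>k<s. Y m k * f k)) = f i" if "i < s" for i f
    using that by (simp add: sum_mult_sum_swap[symmetric] ZY sum_delta_lessThan)
  have Y_Z: "(\<Sum>m<s. Y i m * (\<Sum>k<s. Z m k * f k)) = f i" if "i < s" for i f
    using that by (simp add: sum_mult_sum_swap[symmetric] YZ sum_delta_lessThan)
  define d where "d i k = (\<Sum>m<s. Z i m * (l m * Y m k))" for i k
  define t where "t i = (\<Sum>m<s. Z i m * 1)" for i
  have exact_basis: "exact_step s x d t (binomial_poly j)" if j: "j < s" for j
    unfolding exact_step_def
  proof (intro allI impI)
    fix i assume i: "i < s"
    define b where "b = poly (binomial_poly j :: 'a poly)"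
    \<comment> \<open>It suffices to check the equations after multiplication by the invertible \<open>Y\<close>, where they
      decouple into the recursions for the moments.\<close>
    have row: "(\<Sum>k<s. Y m k * b (x k)) = l m * (\<Sum>k<s. Y m k * b (x k - 1)) + 1 * b 0"
      if m: "m < s" for m
    proof (cases j)
      case 0
      then have "(\<Sum>k<s. Y m k) = - (1 / (l m - 1))"
        using mom[OF m, of 0] j by (simp add: binomial_poly_0)
      then show ?thesis using 0 l1[OF m] by (simp add: b_def binomial_poly_0 field_simps)
    next
      case (Suc n)
      define v where "v = (1 / (l m - 1)) ^ Suc j"
      have "(1 / (l m - 1)) ^ Suc n = (l m - 1) * v"
        using l1[OF m] Suc by (simp add: v_def)
      then have "(\<Sum>k<s. Y m k * b (x k)) = - ((l m - 1) * v) + - v"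
        using mom[OF m, of n] mom[OF m, of j] j Suc
        by (simp add: b_def sum_binomial_shift[where x = x] v_def del: power_Suc)
      moreover have "(\<Sum>k<s. Y m k * b (x k - 1)) = - v"
        using mom[OF m, of j] j by (simp add: b_def v_def)
      moreover have "b 0 = 0" using Suc by (simp add: b_def poly_binomial_poly)
      ultimately show ?thesis by (simp add: algebra_simps)
    qed
    have "b (x i) = (\<Sum>m<s. Z i m * (\<Sum>k<s. Y m k * b (x k)))"
      using Z_Y[OF i, of "\<lambda>k. b (x k)"] by simp
    also have "\<dots> = (\<Sum>m<s. Z i m * (\<Sum>k<s. l m * Y m k * b (x k - 1))) + t i * b 0"
      by (simp add: row t_def sum.distrib sum_distrib_right sum_distrib_left algebra_simps)
    also have "\<dots> = (\<Sum>k<s. d i k * b (x k - 1)) + t i * b 0"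
      unfolding d_def by (simp add: sum_mult_sum_swap)
    finally show "poly (binomial_poly j) (x i) =
        (\<Sum>k<s. d i k * poly (binomial_poly j) (x k - 1)) + t i * poly (binomial_poly j) 0"
      by (simp add: b_def)
  qed
  show ?thesis
  proof (rule that[of d t], rule iffI)
    fix D :: "'a mat" and \<theta> :: "'a vec"
    assume D: "D \<in> carrier_mat s s" and \<theta>: "\<theta> \<in> carrier_vec s"
    {
      assume asm: "(\<forall>p. degree p < s \<longrightarrow> exact_step s x (\<lambda>i k. D $$ (i, k)) (\<lambda>i. \<theta> $ i) p) \<and>
        l ` {..<s} \<subseteq> spectrum D"
      then have E: "\<And>p. degree p < s \<Longrightarrow>
          exact_step s x (\<lambda>i k. D $$ (i, k)) (\<lambda>i. \<theta> $ i) p" by blast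
      have rows: "(\<forall>k<s. (\<Sum>i<s. Y m i * D $$ (i, k)) = l m * Y m k) \<and>
          (\<Sum>i<s. Y m i * \<theta> $ i) = 1" if m: "m < s" for m
      proof -
        have "l m \<in> spectrum D" using asm m by auto
        then obtain y where y: "\<And>k. k < s \<Longrightarrow> (\<Sum>i<s. y i * D $$ (i, k)) = l m * y k"
            "(\<Sum>i<s. y i * \<theta> $ i) = 1"
          using normalized_left_eigenvector[OF inj D E _ l1[OF m]] by metis
        have "(\<Sum>k<s. (y k - Y m k) * poly (binomial_poly j) (x k - 1)) = 0" if "j < s" for j
          using left_eigenvector_moments[OF E y(1) l1[OF m] that] mom[OF m that] y(2)
          by (simp add: algebra_simps sum_subtractf)
        then have "y k - Y m k = 0" if "k < s" for k
          using weights_zero_if_binomial_moments_zero[of x s "\<lambda>k. y k - Y m k" k, OF inj] that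
          by blast
        then have "y k = Y m k" if "k < s" for k using that by simp
        then show ?thesis using y by simp
      qed
      have "D $$ (i, k) = d i k" if "i < s" "k < s" for i k
        using Z_Y[OF that(1), of "\<lambda>i. D $$ (i, k)"] rows that(2) by (simp add: d_def)
      moreover have "\<theta> $ i = t i" if "i < s" for i
        using Z_Y[OF that, of "\<lambda>i. \<theta> $ i"] rows by (simp add: t_def)
      ultimately show "D = mat s s (\<lambda>(i, k). d i k) \<and> \<theta> = vec s t"
        using D \<theta> by (auto simp: mat_eq_iff vec_eq_iff)
    next
      assume eq: "D = mat s s (\<lambda>(i, k). d i k) \<and> \<theta> = vec s t"
      have same: "exact_step s x (\<lambda>i k. D $$ (i, k)) (\<lambda>i. \<theta> $ i) p \<longleftrightarrow> exact_step s x d t p" for p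
        using eq by (simp add: exact_step_def)
      have exact: "exact_step s x d t p" if "degree p < s" for p
        by (rule exact_step_from_basis[where B = binomial_poly])
          (use that in \<open>simp_all add: exact_basis degree_binomial_poly binomial_poly_0\<close>)
      have eigen: "l m \<in> spectrum D" if m: "m < s" for m
        unfolding mem_spectrum_iff_left_eigenvector[OF D]
      proof (intro exI[of _ "Y m"] conjI allI impI)
        show "\<exists>i<s. Y m i \<noteq> 0"
          using YZ[OF m m] by (metis (no_types, lifting) lessThan_iff mult_zero_left
              sum.neutral zero_neq_one)
        fix k assume "k < s"
        then show "(\<Sum>i<s. Y m i * D $$ (i, k)) = l m * Y m k"
          using Y_Z[OF m, of "\<lambda>m. l m * Y m k"] eq by (simp add: d_def)
      qed
      show "(\<forall>p. degree p < s \<longrightarrow>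
          exact_step s x (\<lambda>i k. D $$ (i, k)) (\<lambda>i. \<theta> $ i) p) \<and> l ` {..<s} \<subseteq> spectrum D"
        unfolding same using exact eigen by auto
    }
  qed
qed

section \<open>Complex conjugation and the theorem\<close>

text \<open>
  An \<open>s \<times> s\<close> matrix has at most \<open>s\<close> eigenvalues, so \<open>s\<close> distinct ones exhaust its spectrum.
\<close>

lemma spectrum_eq_iff_subset:
  fixes D :: "'a :: field mat"
  assumes "D \<in> carrier_mat s s" "inj_on l {..<s}"
  shows "spectrum D = l ` {..<s} \<longleftrightarrow> l ` {..<s} \<subseteq> spectrum D"
proof
  assume "l ` {..<s} \<subseteq> spectrum D"
  moreover have "card (spectrum D) \<le> card (l ` {..<s})"
    using card_finite_spectrum(2)[OF assms(1)] card_image[OF assms(2)] by simp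
  ultimately show "spectrum D = l ` {..<s}"
    using card_seteq[OF card_finite_spectrum(1)[OF assms(1)]] by blast
qed simp

lemma consistent_step_cnj:
  assumes C: "consistent_step s c D \<theta>"
  shows "consistent_step s c (map_mat cnj D) (map_vec cnj \<theta>)"
proof -
  have D: "D \<in> carrier_mat s s" and \<theta>: "\<theta> \<in> carrier_vec s"
    using C by (auto simp: consistent_step_def)
  have real: "map_mat cnj (node_mat s e h) = node_mat s e h" for e h
    by (auto simp: node_mat_def)
  have th: "map_mat cnj (theta_mat s \<theta>) = theta_mat s (map_vec cnj \<theta>)"
    using \<theta> by (auto simp: theta_mat_def)
  have "node_mat s c h = map_mat cnj D * node_mat s (\<lambda>i. c i - 1) h +
      theta_mat s (map_vec cnj \<theta>)" if "h > 0" for h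
  proof -
    have "node_mat s c h = D * node_mat s (\<lambda>i. c i - 1) h + theta_mat s \<theta>"
      using C that by (simp add: consistent_step_def)
    then have "map_mat cnj (node_mat s c h) =
        map_mat cnj (D * node_mat s (\<lambda>i. c i - 1) h + theta_mat s \<theta>)" by simp
    also have "\<dots> = map_mat cnj D * map_mat cnj (node_mat s (\<lambda>i. c i - 1) h) +
        map_mat cnj (theta_mat s \<theta>)"
      using D by (auto simp: mat_eq_iff node_mat_def theta_mat_def scalar_prod_def)
    finally show ?thesis by (simp only: real th)
  qed
  then show ?thesis using D \<theta> by (simp add: consistent_step_def)
qed

lemma cnj_mem_spectrum_cnj:
  assumes D: "D \<in> carrier_mat s s" and k: "k \<in> spectrum D"
  shows "cnj k \<in> spectrum (map_mat cnj D)"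
proof -
  obtain y where y: "\<exists>i<s. y i \<noteq> 0" "\<forall>j<s. (\<Sum>i<s. y i * D $$ (i, j)) = k * y j"
    using k mem_spectrum_iff_left_eigenvector[OF D] by blast
  have "(\<Sum>i<s. cnj (y i) * map_mat cnj D $$ (i, j)) = cnj k * cnj (y j)" if "j < s" for j
    using arg_cong[OF y(2)[rule_format, OF that], of cnj] D that by simp
  moreover have "\<exists>i<s. cnj (y i) \<noteq> 0" using y(1) by simp
  ultimately show ?thesis
    using mem_spectrum_iff_left_eigenvector[of "map_mat cnj D" s "cnj k"] D
    by (auto intro!: exI[of _ "\<lambda>i. cnj (y i)"])
qed

theorem theorem5:
  fixes s :: nat and c :: "nat \<Rightarrow> real" and lam :: "nat \<Rightarrow> complex"
  assumes "s \<ge> 1"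
    and "strict_mono_on {..<s} c"
    and "\<forall>i<s. 0 \<le> c i \<and> c i \<le> 1"
    and "inj_on lam {..<s}"
    and "\<forall>i<s. lam i \<noteq> 1"
  shows "(\<exists>!(\<theta>, D). \<theta> \<in> carrier_vec s \<and> D \<in> carrier_mat s s \<and>
            consistent_step s c D \<theta> \<and> spectrum D = lam ` {..<s}) \<and>
         (cnj ` (lam ` {..<s}) \<subseteq> lam ` {..<s} \<longrightarrow>
            (\<forall>\<theta> D. \<theta> \<in> carrier_vec s \<and> D \<in> carrier_mat s s \<and>
               consistent_step s c D \<theta> \<and> spectrum D = lam ` {..<s} \<longrightarrow>
               (\<forall>i<s. \<theta> $ i \<in> \<real>) \<and> (\<forall>i<s. \<forall>j<s. D $$ (i, j) \<in> \<real>)))"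
proof -
  have inj: "inj_on (\<lambda>i. complex_of_real (c i)) {..<s}"
    using strict_mono_on_imp_inj_on[OF assms(2)] by (simp add: inj_on_def)
  obtain d t where char: "\<And>D \<theta>. D \<in> carrier_mat s s \<Longrightarrow> \<theta> \<in> carrier_vec s \<Longrightarrow>
      (\<forall>p. degree p < s \<longrightarrow> exact_step s (\<lambda>i. complex_of_real (c i))
          (\<lambda>i k. D $$ (i, k)) (\<lambda>i. \<theta> $ i) p) \<and> lam ` {..<s} \<subseteq> spectrum D \<longleftrightarrow>
      D = mat s s (\<lambda>(i, k). d i k) \<and> \<theta> = vec s t"
    using step_with_spectrum_characterization[OF inj assms(4)] assms(5) by blast
  define D0 where "D0 = mat s s (\<lambda>(i, k). d i k)"
  have sol: "\<theta> \<in> carrier_vec s \<and> D \<in> carrier_mat s s \<and>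
      consistent_step s c D \<theta> \<and> spectrum D = lam ` {..<s} \<longleftrightarrow> \<theta> = vec s t \<and> D = D0" for \<theta> D
  proof (cases "\<theta> \<in> carrier_vec s \<and> D \<in> carrier_mat s s")
    case True
    then show ?thesis
      using char[of D \<theta>] consistent_step_iff_exact[of D s \<theta> c]
        spectrum_eq_iff_subset[of D s lam] assms(4) by (auto simp: D0_def)
  qed (auto simp: D0_def)
  have unique: "\<exists>!(\<theta>, D). \<theta> \<in> carrier_vec s \<and> D \<in> carrier_mat s s \<and>
            consistent_step s c D \<theta> \<and> spectrum D = lam ` {..<s}"
    unfolding sol by (rule ex1I[of _ "(vec s t, D0)"]) auto
  have real: "(\<forall>i<s. \<theta> $ i \<in> \<real>) \<and> (\<forall>i<s. \<forall>j<s. D $$ (i, j) \<in> \<real>)"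
    if stable: "cnj ` (lam ` {..<s}) \<subseteq> lam ` {..<s}" and
      S: "\<theta> \<in> carrier_vec s \<and> D \<in> carrier_mat s s \<and>
               consistent_step s c D \<theta> \<and> spectrum D = lam ` {..<s}" for \<theta> D
  proof -
    have D: "D \<in> carrier_mat s s" and \<theta>: "\<theta> \<in> carrier_vec s" using S by auto
    have "lam ` {..<s} \<subseteq> spectrum (map_mat cnj D)"
    proof
      fix k assume "k \<in> lam ` {..<s}"
      then have "cnj k \<in> spectrum D" using stable S by auto
      then show "k \<in> spectrum (map_mat cnj D)" using cnj_mem_spectrum_cnj[OF D] by fastforce
    qed
    then have "spectrum (map_mat cnj D) = lam ` {..<s}"
      using spectrum_eq_iff_subset[of "map_mat cnj D" s lam] assms(4) D by simp
    then have "map_vec cnj \<theta> = vec s t \<and> map_mat cnj D = D0"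
      using sol[of "map_vec cnj \<theta>" "map_mat cnj D"] consistent_step_cnj[of s c D \<theta>] S by simp
    then have "map_vec cnj \<theta> = \<theta>" "map_mat cnj D = D" using sol[of \<theta> D] S by auto
    then have "cnj (\<theta> $ i) = \<theta> $ i" "cnj (D $$ (i, j)) = D $$ (i, j)" if "i < s" "j < s" for i j
      using that D \<theta> by (metis index_map_vec(1) carrier_vecD,
          metis index_map_mat(1) carrier_matD)
    then show ?thesis by (auto simp: Reals_cnj_iff)
  qed
  show ?thesis by (rule conjI[OF unique], intro impI allI, rule real)
qed

end
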